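(* Let $X$ be an Archimedean vector lattice and $Y$ a regular sublattice of $X$. Then for every net $(x_\alpha)$ in $Y$ that is order bounded in $Y$, one has $x_\alpha\xrightarrow{\rm o}0$ in $Y$ if and only if $x_\alpha\xrightarrow{\rm o}0$ in $X$.
   Context: All vector lattices are real and Archimedean. A sublattice $Y$ of $X$ is regular if for every subset $A$ of $Y$ whose infimum exists in $Y$, the infimum of $A$ exists in $X$ and equals the infimum in $Y$. A net $(x_\alpha)_{\alpha\in\Gamma}$ in a vector lattice $Z$ converges in order to $x\in Z$, written $x_\alpha\xrightarrow{\rm o}x$ in $Z$, if there is a net $(a_\gamma)_{\gamma\in\Lambda}$ in $Z$ (possibly over a different index set) with $a_\gamma\downarrow 0$ in $Z$ such that for every $\gamma\in\Lambda$ there is $\alpha_0\in\Gamma$ with $|x_\alpha-x|\le a_\gamma$ for all $\alpha\ge\alpha_0$. *)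

theory Defs
  imports "HOL-Analysis.Analysis" "HOL-Library.Lattice_Algebras" "HOL-Library.Lub_Glb"
begin

text \<open>The absolute value of \<^class>\<open>lattice_ab_group_add_abs\<close> is \<open>\<bar>x\<bar> = sup x (- x)\<close>.\<close>

class vector_lattice = ordered_real_vector + lattice_ab_group_add_abs

class archimedean_vector_lattice = vector_lattice +
  assumes archimedean: "(\<And>n::nat. real n *\<^sub>R x \<le> y) \<Longrightarrow> x \<le> 0"

instance real :: archimedean_vector_lattice
proof
  fix x y :: real
  assume *: "\<And>n::nat. real n *\<^sub>R x \<le> y"
  show "x \<le> 0"
  proof (rule ccontr)
    assume "\<not> x \<le> 0"
    then obtain n :: nat where "y < real n * x"
      using reals_Archimedean3[of x] by auto
    with *[of n] show False by simp
  qed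
qed

definition vector_sublattice :: "'a::vector_lattice set \<Rightarrow> bool" where
  "vector_sublattice Y \<longleftrightarrow>
     subspace Y \<and> (\<forall>x\<in>Y. \<forall>y\<in>Y. sup x y \<in> Y \<and> inf x y \<in> Y)"

text \<open>
  \<^term>\<open>isGlb Z A m\<close> says that \<open>m\<close> is the infimum of \<open>A\<close> computed in \<open>Z\<close>. The empty set is
  left out: it has an infimum in \<open>Y\<close> only if \<open>Y = {0}\<close>, and the zero sublattice is regular.
\<close>

definition regular_sublattice :: "'a::vector_lattice set \<Rightarrow> bool" where
  "regular_sublattice Y \<longleftrightarrow> vector_sublattice Y \<and>
     (\<forall>A m. A \<subseteq> Y \<and> A \<noteq> {} \<and> isGlb Y A m \<longrightarrow> isGlb UNIV A m)"

definition directed_set :: "'i set \<Rightarrow> ('i \<times> 'i) set \<Rightarrow> bool" where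
  "directed_set \<Gamma> r \<longleftrightarrow> \<Gamma> \<noteq> {} \<and> preorder_on \<Gamma> r \<and>
     (\<forall>\<alpha>\<in>\<Gamma>. \<forall>\<beta>\<in>\<Gamma>. \<exists>\<gamma>\<in>\<Gamma>. (\<alpha>, \<gamma>) \<in> r \<and> (\<beta>, \<gamma>) \<in> r)"

definition net_in :: "'a set \<Rightarrow> 'i set \<Rightarrow> ('i \<times> 'i) set \<Rightarrow> ('i \<Rightarrow> 'a) \<Rightarrow> bool" where
  "net_in Z \<Gamma> r x \<longleftrightarrow> directed_set \<Gamma> r \<and> (\<forall>\<alpha>\<in>\<Gamma>. x \<alpha> \<in> Z)"

definition decreases_to_zero_in ::
    "'a::vector_lattice set \<Rightarrow> 'i set \<Rightarrow> ('i \<times> 'i) set \<Rightarrow> ('i \<Rightarrow> 'a) \<Rightarrow> bool" where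
  "decreases_to_zero_in Z \<Lambda> s a \<longleftrightarrow> net_in Z \<Lambda> s a \<and>
     (\<forall>\<gamma> \<delta>. (\<gamma>, \<delta>) \<in> s \<longrightarrow> a \<delta> \<le> a \<gamma>) \<and> isGlb Z (a ` \<Lambda>) 0"

definition order_dominated ::
    "'i set \<Rightarrow> ('i \<times> 'i) set \<Rightarrow> ('i \<Rightarrow> 'a::vector_lattice) \<Rightarrow> 'a \<Rightarrow> 'j set \<Rightarrow> ('j \<Rightarrow> 'a) \<Rightarrow> bool" where
  "order_dominated \<Gamma> r x l \<Lambda> a \<longleftrightarrow>
     (\<forall>\<gamma>\<in>\<Lambda>. \<exists>\<alpha>\<^sub>0\<in>\<Gamma>. \<forall>\<alpha>\<in>\<Gamma>. (\<alpha>\<^sub>0, \<alpha>) \<in> r \<longrightarrow> \<bar>x \<alpha> - l\<bar> \<le> a \<gamma>)"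

text \<open>
  HOL cannot quantify existentially over index types, so the index set of the dominating net is
  taken among the sets of elements of type \<^typ>\<open>'a\<close>. This is no restriction: the lemma
  \<open>order_converges_inI\<close> below admits dominating nets over arbitrary index types.
\<close>

definition order_converges_in ::
    "'a::vector_lattice set \<Rightarrow> 'i set \<Rightarrow> ('i \<times> 'i) set \<Rightarrow> ('i \<Rightarrow> 'a) \<Rightarrow> 'a \<Rightarrow> bool" where
  "order_converges_in Z \<Gamma> r x l \<longleftrightarrow> net_in Z \<Gamma> r x \<and> l \<in> Z \<and>
     (\<exists>(\<Lambda> :: 'a set) s a. decreases_to_zero_in Z \<Lambda> s a \<and> order_dominated \<Gamma> r x l \<Lambda> a)"

lemma order_converges_inI:
  fixes Z :: "'a::vector_lattice set" and \<Lambda> :: "'j set"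
  assumes "net_in Z \<Gamma> r x" "l \<in> Z"
    and dec: "decreases_to_zero_in Z \<Lambda> s a" and dom: "order_dominated \<Gamma> r x l \<Lambda> a"
  shows "order_converges_in Z \<Gamma> r x l"
proof -
  let ?D = "a ` \<Lambda>"
  let ?s = "{(u, v). u \<in> ?D \<and> v \<in> ?D \<and> v \<le> u}"
  have pre: "preorder_on ?D ?s"
    by (auto simp: preorder_on_def refl_on_def trans_def)
  have dir: "\<exists>w\<in>?D. (u, w) \<in> ?s \<and> (v, w) \<in> ?s" if "u \<in> ?D" "v \<in> ?D" for u v
    using that dec unfolding decreases_to_zero_in_def net_in_def directed_set_def by blast
  have "decreases_to_zero_in Z ?D ?s (\<lambda>u. u)"
    using dec pre dir
    unfolding decreases_to_zero_in_def net_in_def directed_set_def by auto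
  moreover have "order_dominated \<Gamma> r x l ?D (\<lambda>u. u)"
    using dom unfolding order_dominated_def by blast
  ultimately show ?thesis
    using assms(1,2) unfolding order_converges_in_def by blast
qed

definition order_bounded_in :: "'a::vector_lattice set \<Rightarrow> 'a set \<Rightarrow> bool" where
  "order_bounded_in Z A \<longleftrightarrow> (\<exists>u\<in>Z. \<exists>v\<in>Z. A \<subseteq> {u..v})"

end

theory Submission
  imports Defs
begin

text \<open>
  The candidate dominating net in \<open>Y\<close> consists of all elements of \<open>Y\<close> that eventually dominate
  \<open>\<bar>x \<alpha>\<bar>\<close>. If \<open>w \<in> Y\<close> lies below all of them, then the Archimedean property
  gives \<open>w = sup\<^sub>Y {inf w \<bar>x \<alpha>\<bar> | \<alpha> \<ge> \<alpha>\<^sub>0}\<close> for every \<open>\<alpha>\<^sub>0\<close>. By regularity this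
  supremum persists in \<open>X\<close>, so \<open>w\<close> lies below every element of \<open>X\<close> that eventually dominates
  the net, and hence \<open>w \<le> 0\<close>.
\<close>

lemma isGlb_iff: "isGlb Z A m \<longleftrightarrow> m \<in> Z \<and> (\<forall>a\<in>A. m \<le> a) \<and> (\<forall>z\<in>Z. (\<forall>a\<in>A. z \<le> a) \<longrightarrow> z \<le> m)"
  by (auto simp: isGlb_def isLb_def greatestP_def setle_def setge_def)

lemma vector_sublattice_abs:
  assumes "vector_sublattice Y" "x \<in> Y"
  shows "\<bar>x\<bar> \<in> Y"
  using assms unfolding vector_sublattice_def abs_lattice by (simp add: subspace_neg)

text \<open>Any upper bound of \<open>S\<close> in \<open>Y\<close> can be lowered by
  \<open>w - z\<close> and remains one. Repeating this from \<open>v\<close> never leads below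
  \<open>w\<close>, so the Archimedean property rules out any positive part of
  \<open>w - z\<close>.\<close>

lemma le_upper_bound_of_infs:
  fixes Y :: "'a::archimedean_vector_lattice set"
  assumes "subspace Y" and w: "w \<in> Y" and z: "z \<in> Y" and v: "v \<in> Y" "\<forall>s\<in>S. s \<le> v"
    and lower: "\<And>v. v \<in> Y \<Longrightarrow> \<forall>s\<in>S. s \<le> v \<Longrightarrow> w \<le> v"
    and upper: "\<forall>s\<in>S. inf w s \<le> z"
  shows "w \<le> z"
proof -
  \<comment> \<open>\<open>s + w = sup s w + inf s w \<le> b + z\<close> for every upper bound \<open>b\<close>, so \<open>b - (w - z)\<close> is again
      an upper bound of \<open>S\<close>.\<close>
  have step: "s \<le> b - (w - z)" if "b \<in> Y" "\<forall>s\<in>S. s \<le> b" "s \<in> S" for b s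
  proof -
    have "w + s = sup w s + inf w s" by (rule add_eq_inf_sup)
    also have "\<dots> \<le> b + z"
      using that lower[of b] upper by (intro add_mono) auto
    finally show ?thesis by (simp add: algebra_simps)
  qed
  have iter: "v - real n *\<^sub>R (w - z) \<in> Y \<and> (\<forall>s\<in>S. s \<le> v - real n *\<^sub>R (w - z))" for n
  proof (induction n)
    case 0
    then show ?case using v by simp
  next
    case (Suc n)
    have eq: "v - real (Suc n) *\<^sub>R (w - z) = v - real n *\<^sub>R (w - z) - (w - z)"
      by (simp add: algebra_simps)
    show ?case unfolding eq
      using Suc step assms(1) w z by (auto intro: subspace_diff)
  qed
  \<comment> \<open>The bound \<open>v - w\<close> does not depend on \<open>n\<close>, which is
    what \<open>archimedean\<close> requires.\<close>
  have "real n *\<^sub>R (w - z) \<le> v - w" for n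
  proof -
    have "w \<le> v - real n *\<^sub>R (w - z)"
      using iter[of n] by (intro lower) auto
    then show ?thesis by (metis diff_le_eq le_diff_eq add.commute)
  qed
  then have "w - z \<le> 0" by (rule archimedean)
  then show ?thesis by simp
qed

text \<open>Here \<open>a\<close> may lie outside \<open>Y\<close>, so \<open>lower\<close> does not
  apply to it. Regularity bridges the gap: it speaks of infima, so the supremum \<open>w\<close> of
  the elements \<open>inf w s\<close> is recast as the infimum 0 of the differences
  \<open>w - inf w s\<close>.\<close>

lemma regular_sublattice_lower_bound_le:
  fixes Y :: "'a::archimedean_vector_lattice set"
  assumes reg: "regular_sublattice Y" and S: "S \<subseteq> Y" "S \<noteq> {}"
    and w: "w \<in> Y" and v: "v \<in> Y" "\<forall>s\<in>S. s \<le> v"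
    and lower: "\<And>v. v \<in> Y \<Longrightarrow> \<forall>s\<in>S. s \<le> v \<Longrightarrow> w \<le> v"
    and a: "\<forall>s\<in>S. s \<le> a"
  shows "w \<le> a"
proof -
  let ?A = "(\<lambda>s. w - inf w s) ` S"
  have sub: "subspace Y" and inf: "\<And>s. s \<in> S \<Longrightarrow> inf w s \<in> Y"
    using reg S(1) w unfolding regular_sublattice_def vector_sublattice_def by auto
  have greatest: "z \<le> 0" if z: "z \<in> Y" "\<forall>b\<in>?A. z \<le> b" for z
  proof -
    \<comment> \<open>A lower bound \<open>z\<close> of the differences makes \<open>w - z\<close>
      an upper bound of all \<open>inf w s\<close>.\<close>
    have "w \<le> w - z"
    proof (rule le_upper_bound_of_infs[OF sub w _ v lower])
      show "w - z \<in> Y" by (intro subspace_diff sub w z(1))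
      show "\<forall>s\<in>S. inf w s \<le> w - z"
      proof
        fix s assume "s \<in> S"
        then have "z \<le> w - inf w s" using z(2) by blast
        then show "inf w s \<le> w - z" by (simp only: le_diff_eq add.commute)
      qed
    qed
    then show ?thesis by simp
  qed
  have "isGlb Y ?A 0"
    unfolding isGlb_iff
  proof (intro conjI ballI impI)
    show "0 \<le> b" if "b \<in> ?A" for b
      using that by (elim imageE) (simp only: diff_ge_0_iff_ge inf_le1)
  qed (use greatest subspace_0[OF sub] in blast)+
  moreover have "?A \<subseteq> Y"
    by (intro image_subsetI subspace_diff sub w inf)
  moreover have "?A \<noteq> {}"
    using S(2) by blast
  ultimately have "isGlb UNIV ?A 0"
    using reg unfolding regular_sublattice_def by blast
  \<comment> \<open>Since \<open>inf w s \<le> s \<le> a\<close>, the element \<open>w - a\<close>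
    is a lower bound of \<open>?A\<close> in the whole space, where the infimum is now known to be
    0.\<close>
  moreover have "w - a \<le> w - inf w s" if "s \<in> S" for s
    using a that by (intro diff_left_mono) (auto intro: le_infI2)
  ultimately have "w - a \<le> 0" unfolding isGlb_iff by blast
  then show ?thesis by simp
qed

text \<open>The same dominating net serves: by regularity its range keeps the infimum 0 in the
  larger space.\<close>

lemma order_converges_in_UNIV_if:
  assumes reg: "regular_sublattice Y" and conv: "order_converges_in Y \<Gamma> r x l"
  shows "order_converges_in UNIV \<Gamma> r x l"
proof -
  obtain \<Lambda> :: "'a set" and s a
    where dec: "decreases_to_zero_in Y \<Lambda> s a" and dom: "order_dominated \<Gamma> r x l \<Lambda> a"
    using conv unfolding order_converges_in_def by blast
  have "a ` \<Lambda> \<subseteq> Y" "a ` \<Lambda> \<noteq> {}" "isGlb Y (a ` \<Lambda>) 0"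
    using dec unfolding decreases_to_zero_in_def net_in_def directed_set_def by auto
  then have "isGlb UNIV (a ` \<Lambda>) 0"
    using reg unfolding regular_sublattice_def by blast
  then have "decreases_to_zero_in UNIV \<Lambda> s a"
    using dec unfolding decreases_to_zero_in_def net_in_def by simp
  then show ?thesis
    using conv dom unfolding order_converges_in_def net_in_def by auto
qed

lemma order_converges_in_regular_sublattice:
  fixes Y :: "'a::archimedean_vector_lattice set"
  assumes reg: "regular_sublattice Y" and net: "net_in Y \<Gamma> r x"
    and bdd: "order_bounded_in Y (x ` \<Gamma>)" and conv: "order_converges_in UNIV \<Gamma> r x 0"
  shows "order_converges_in Y \<Gamma> r x 0"
proof -
  have lat: "vector_sublattice Y" and sub: "subspace Y"
    using reg unfolding regular_sublattice_def vector_sublattice_def by auto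
  have ne: "\<Gamma> \<noteq> {}" and refl: "\<And>\<alpha>. \<alpha> \<in> \<Gamma> \<Longrightarrow> (\<alpha>, \<alpha>) \<in> r" and tr: "trans r"
    and dir: "\<And>\<alpha> \<beta>. \<alpha> \<in> \<Gamma> \<Longrightarrow> \<beta> \<in> \<Gamma> \<Longrightarrow> \<exists>\<gamma>\<in>\<Gamma>. (\<alpha>, \<gamma>) \<in> r \<and> (\<beta>, \<gamma>) \<in> r"
    and x: "\<And>\<alpha>. \<alpha> \<in> \<Gamma> \<Longrightarrow> x \<alpha> \<in> Y"
    using net unfolding net_in_def directed_set_def preorder_on_def refl_on_def by auto
  define tail where "tail \<alpha>\<^sub>0 = {\<bar>x \<alpha>\<bar> | \<alpha>. \<alpha> \<in> \<Gamma> \<and> (\<alpha>\<^sub>0, \<alpha>) \<in> r}" for \<alpha>\<^sub>0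
  have tail_Y: "tail \<alpha> \<subseteq> Y" for \<alpha>
    using x vector_sublattice_abs[OF lat] unfolding tail_def by auto
  have tail_ne: "tail \<alpha> \<noteq> {}" if "\<alpha> \<in> \<Gamma>" for \<alpha>
    using that refl unfolding tail_def by auto
  have tail_mono: "tail \<beta> \<subseteq> tail \<alpha>" if "(\<alpha>, \<beta>) \<in> r" for \<alpha> \<beta>
    using that tr unfolding tail_def by (auto dest: transD)
  obtain b c where b: "b \<in> Y" "c \<in> Y" "x ` \<Gamma> \<subseteq> {b..c}"
    using bdd unfolding order_bounded_in_def by blast
  \<comment> \<open>From \<open>b \<le> x \<alpha> \<le> c\<close> follows
    \<open>\<bar>x \<alpha>\<bar> \<le> u\<close>. This \<open>u\<close> makes \<open>D\<close>
    nonempty and is the upper bound in \<open>Y\<close> from which the Archimedean argument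
    starts.\<close>
  define u where "u = sup c (- b)"
  have u_Y: "u \<in> Y"
    using lat b(1,2) subspace_neg[OF sub] unfolding u_def vector_sublattice_def by auto
  have u: "\<forall>s\<in>tail \<alpha>. s \<le> u" for \<alpha>
  proof -
    have "\<bar>x \<beta>\<bar> \<le> u" if "\<beta> \<in> \<Gamma>" for \<beta>
    proof -
      have "b \<le> x \<beta>" "x \<beta> \<le> c" using b(3) that by auto
      then show ?thesis
        unfolding u_def abs_lattice by (intro sup_mono) simp_all
    qed
    then show ?thesis unfolding tail_def by blast
  qed
  define D where "D = {v \<in> Y. \<exists>\<alpha>\<in>\<Gamma>. \<forall>s\<in>tail \<alpha>. s \<le> v}"
  \<comment> \<open>The order is reversed, so that the identity on \<open>D\<close> is a decreasing
    net; closure of \<open>D\<close> under \<open>inf\<close> makes it directed.\<close>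
  let ?s = "{(v, w). v \<in> D \<and> w \<in> D \<and> w \<le> v}"
  have D_inf: "inf v w \<in> D" if vw: "v \<in> D" "w \<in> D" for v w
  proof -
    obtain \<alpha> \<beta> where "\<alpha> \<in> \<Gamma>" "\<forall>s\<in>tail \<alpha>. s \<le> v" "\<beta> \<in> \<Gamma>" "\<forall>s\<in>tail \<beta>. s \<le> w"
      using vw unfolding D_def by auto
    moreover from this obtain \<gamma> where "\<gamma> \<in> \<Gamma>" "(\<alpha>, \<gamma>) \<in> r" "(\<beta>, \<gamma>) \<in> r"
      using dir by blast
    ultimately have "\<gamma> \<in> \<Gamma>" "\<forall>s\<in>tail \<gamma>. s \<le> inf v w"
      using tail_mono[of \<alpha> \<gamma>] tail_mono[of \<beta> \<gamma>] by auto
    then show ?thesis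
      using vw lat unfolding D_def vector_sublattice_def by auto
  qed
  have D_nonneg: "0 \<le> v" if v: "v \<in> D" for v
  proof -
    obtain \<alpha> where "\<alpha> \<in> \<Gamma>" "\<forall>s\<in>tail \<alpha>. s \<le> v" using v unfolding D_def by auto
    then have "\<bar>x \<alpha>\<bar> \<le> v" using refl unfolding tail_def by auto
    then show ?thesis using abs_ge_zero order_trans by blast
  qed
  have D_lower: "w \<le> 0" if w: "w \<in> Y" "\<forall>v\<in>D. w \<le> v" for w
  proof -
    obtain \<Lambda> :: "'a set" and s a
      where dec: "decreases_to_zero_in UNIV \<Lambda> s a" and dom: "order_dominated \<Gamma> r x 0 \<Lambda> a"
      using conv unfolding order_converges_in_def by blast
    \<comment> \<open>\<open>a \<gamma>\<close> bounds some tail but need not belong to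
      \<open>Y\<close>, hence not to \<open>D\<close>. All upper bounds of that tail in
      \<open>Y\<close> do belong to \<open>D\<close>, so \<open>w\<close> lies below them and the
      preceding transfer applies with the tail as \<open>S\<close>.\<close>
    have "w \<le> a \<gamma>" if \<gamma>: "\<gamma> \<in> \<Lambda>" for \<gamma>
    proof -
      obtain \<alpha> where \<alpha>: "\<alpha> \<in> \<Gamma>" "\<forall>s\<in>tail \<alpha>. s \<le> a \<gamma>"
        using dom \<gamma> unfolding order_dominated_def tail_def by fastforce
      have "w \<le> v" if "v \<in> Y" "\<forall>s\<in>tail \<alpha>. s \<le> v" for v
        using w(2) that \<alpha>(1) unfolding D_def by auto
      then show ?thesis
        by (rule regular_sublattice_lower_bound_le
              [OF reg tail_Y tail_ne[OF \<alpha>(1)] w(1) u_Y u _ \<alpha>(2)])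
    qed
    then show ?thesis
      using dec unfolding decreases_to_zero_in_def isGlb_iff by auto
  qed
  have "directed_set D ?s"
    unfolding directed_set_def
  proof (intro conjI ballI)
    show "D \<noteq> {}" using ne u u_Y unfolding D_def by blast
    show "preorder_on D ?s" by (auto simp: preorder_on_def refl_on_def trans_def)
    show "\<exists>z\<in>D. (v, z) \<in> ?s \<and> (w, z) \<in> ?s" if "v \<in> D" "w \<in> D" for v w
      using that D_inf by (intro bexI[of _ "inf v w"]) auto
  qed
  moreover have "isGlb Y D 0"
    using D_nonneg D_lower subspace_0[OF sub] by (simp add: isGlb_iff)
  ultimately have "decreases_to_zero_in Y D ?s (\<lambda>v. v)"
    unfolding decreases_to_zero_in_def net_in_def by (auto simp: D_def)
  moreover have "order_dominated \<Gamma> r x 0 D (\<lambda>v. v)"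
    unfolding order_dominated_def D_def tail_def by auto
  ultimately show ?thesis
    using net subspace_0[OF sub] by (intro order_converges_inI)
qed

theorem corollary2p12:
  fixes Y :: "'a::archimedean_vector_lattice set"
    and \<Gamma> :: "'i set" and r :: "('i \<times> 'i) set" and x :: "'i \<Rightarrow> 'a"
  assumes "regular_sublattice Y"
    and "net_in Y \<Gamma> r x"
    and "order_bounded_in Y (x ` \<Gamma>)"
  shows "order_converges_in Y \<Gamma> r x 0 \<longleftrightarrow> order_converges_in UNIV \<Gamma> r x 0"
  using assms order_converges_in_UNIV_if order_converges_in_regular_sublattice by blast

end
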